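(* Let $n \ge 1$ be an integer and $q \ge 3$ a prime power. Let $\{A^i\}_{i=1}^N$ be a partition of $(\mathbb{F}_q P^n)^n$ such that (1) each part is a product set $A^i = \prod_{j=1}^n A^i_j$ in which every factor $A^i_j \subseteq \mathbb{F}_q P^n$ is an almost-flat, and (2) for each $i$ there is an $(n-1)$-dimensional flat $L^i \subseteq \mathbb{F}_q P^n$ with $A^i \subseteq (L^i)^n$. Then \[ N \ge q^{n(n+1)/2}\left(1 - \frac{1}{q}\left(\frac{q+1}{q-2}\right)^{n}\right). \]
   Context: $\mathbb{F}_q P^n$ denotes the $n$-dimensional projective space over the finite field $\mathbb{F}_q$: its points are the $1$-dimensional linear subspaces of $\mathbb{F}_q^{n+1}$. A flat of $\mathbb{F}_q P^n$ is the set of points contained in a linear subspace $U$ of $\mathbb{F}_q^{n+1}$, and its dimension is $\dim U - 1$ (the empty flat has dimension $-1$); a $k$-flat is a flat of dimension $k$. A subset of $\mathbb{F}_q P^n$ is an almost-flat if it is either a flat, or a $k$-flat minus a flat of dimension at most $k-1$. *)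

theory Defs
  imports "HOL-Analysis.Analysis" "HOL-Library.Disjoint_Sets"
begin

text \<open>
  The finite field with q elements is a type \<open>'a\<close> of class field and finite, and the vector
  space of dimension n + 1 over it is \<open>'a ^ 'm\<close> with \<open>CARD('m) = n + 1\<close>. The constants
  \<open>vec.subspace\<close> and \<open>vec.dim\<close> are the linear-algebra notions over the field \<open>'a\<close>
  (the unqualified \<open>subspace\<close> and \<open>dim\<close> are about real scalars).
\<close>

definition proj_points :: "('a::field ^ 'm) set set" where
  "proj_points = {p. vec.subspace p \<and> vec.dim p = 1}"

definition flat_of :: "('a::field ^ 'm) set \<Rightarrow> ('a ^ 'm) set set" where
  "flat_of U = {p \<in> proj_points. p \<subseteq> U}"

text \<open>Dimensions are integers because the empty flat has dimension -1.\<close>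

definition k_flat :: "int \<Rightarrow> ('a::field ^ 'm) set set \<Rightarrow> bool" where
  "k_flat k F \<longleftrightarrow> (\<exists>U. vec.subspace U \<and> F = flat_of U \<and> k = int (vec.dim U) - 1)"

definition is_flat :: "('a::field ^ 'm) set set \<Rightarrow> bool" where
  "is_flat F \<longleftrightarrow> (\<exists>k. k_flat k F)"

definition almost_flat :: "('a::field ^ 'm) set set \<Rightarrow> bool" where
  "almost_flat A \<longleftrightarrow> is_flat A \<or>
     (\<exists>k l E F. k_flat k E \<and> k_flat l F \<and> l \<le> k - 1 \<and> A = E - F)"

text \<open>
  An n-tuple of points is an extensional function on \<open>{1..n}\<close>, so that products of sets are
  \<open>PiE\<close> products.
\<close>

definition tuples :: "nat \<Rightarrow> 'b set \<Rightarrow> (nat \<Rightarrow> 'b) set" where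
  "tuples n X = ({1..n} \<rightarrow>\<^sub>E X)"

end

theory Submission
  imports Defs
begin

text \<open>
  Replace a point by its nonzero vectors, so that a part becomes a product of sets
  \<open>E j - F j\<close> with subspaces \<open>F j \<subset> E j\<close> of an \<open>n\<close>-dimensional space \<open>U\<close>.
  Almost all tuples of nonzero vectors are linearly independent, and a part contains at most
  \<open>(q - 1) ^ n * q ^ (n * (n - 1) div 2)\<close> independent tuples, up to
  \<open>q + n - 1\<close> times the number of its dependent ones; comparing totals bounds the number
  of parts from below.

  For an independent tuple \<open>x\<close> in a part let \<open>H j\<close> be the span of the vectors other
  than \<open>x j\<close>. If no \<open>E j - F j\<close> meets \<open>H j\<close>, then \<open>F j = E j \<inter> H j\<close>
  is a hyperplane of \<open>E j\<close>. Such tuples number at most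
  \<open>\<Prod>j. card (E j - F j)\<close>; passing to dual bases, whose \<open>j\<close>-th member
  vanishes on \<open>F j\<close> but not on \<open>E j\<close>, bounds them by
  \<open>\<Prod>j. (q - 1) * q ^ n / card (E j)\<close> as well, and the product of the two bounds does
  not depend on the \<open>E j\<close>. Otherwise take the least \<open>j\<close> such that \<open>E j - F j\<close>
  meets \<open>H j\<close> and charge \<open>x\<close>, in equal shares, to the dependent tuples obtained by
  moving \<open>x j\<close> into \<open>(E j - F j) \<inter> H j\<close>. A dependent tuple receives at most
  \<open>q\<close> through the least index through which it is charged, and at most 1 through every
  other index.
\<close>

section \<open>Cardinalities of subspaces over a finite field\<close>

text \<open>Every element of the larger span is \<open>c *s b + s\<close> for exactly one scalar
  \<open>c\<close> and one \<open>s\<close> in \<open>vec.span S\<close>; uniqueness holds because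
  \<open>b\<close> lies outside \<open>vec.span S\<close>.\<close>

lemma card_span_insert:
  fixes b :: "'a::{field,finite} ^ 'm"
  assumes "b \<notin> vec.span S"
  shows "card (vec.span (insert b S)) = CARD('a) * card (vec.span S)"
proof -
  let ?f = "\<lambda>(c, s). c *s b + s"
  have inj: "inj_on ?f (UNIV \<times> vec.span S)"
  proof (rule inj_onI, clarify)
    fix c c' s s' assume s: "s \<in> vec.span S" "s' \<in> vec.span S" and eq: "c *s b + s = c' *s b + s'"
    have "(c - c') *s b = s' - s" using eq by (simp add: vec.scale_left_diff_distrib algebra_simps)
    then have in_span: "(c - c') *s b \<in> vec.span S" using s by (simp add: vec.span_diff)
    have "c - c' = 0"
    proof (rule ccontr)
      define d where "d = c - c'"
      assume "c - c' \<noteq> 0"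
      then have "d \<noteq> 0" by (simp add: d_def)
      then have "inverse d *s (d *s b) = b" by simp
      moreover have "inverse d *s (d *s b) \<in> vec.span S"
        using in_span unfolding d_def by (rule vec.span_scale)
      ultimately show False using assms by simp
    qed
    then show "c = c' \<and> s = s'" using eq by simp
  qed
  have "?f ` (UNIV \<times> vec.span S) = vec.span (insert b S)"
  proof (rule set_eqI)
    fix v
    have "v \<in> ?f ` (UNIV \<times> vec.span S) \<longleftrightarrow> (\<exists>c s. s \<in> vec.span S \<and> v = c *s b + s)"
      by auto
    also have "\<dots> \<longleftrightarrow> (\<exists>c. v - c *s b \<in> vec.span S)"
    proof
      assume "\<exists>c. v - c *s b \<in> vec.span S"
      then obtain c where "v - c *s b \<in> vec.span S" ..
      then show "\<exists>c s. s \<in> vec.span S \<and> v = c *s b + s"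
        by (intro exI[of _ c] exI[of _ "v - c *s b"]) simp
    next
      assume "\<exists>c s. s \<in> vec.span S \<and> v = c *s b + s"
      then obtain c s where "s \<in> vec.span S" "v = c *s b + s" by blast
      then show "\<exists>c. v - c *s b \<in> vec.span S" by (intro exI[of _ c]) simp
    qed
    finally have "v \<in> ?f ` (UNIV \<times> vec.span S) \<longleftrightarrow> (\<exists>c. v - c *s b \<in> vec.span S)" .
    then show "v \<in> ?f ` (UNIV \<times> vec.span S) \<longleftrightarrow> v \<in> vec.span (insert b S)"
      by (simp add: vec.span_breakdown_eq)
  qed
  then show ?thesis
    using card_image[OF inj] by (simp add: card_cartesian_product)
qed

lemma card_span_independent:
  fixes B :: "('a::{field,finite} ^ 'm) set"
  assumes "vec.independent B"
  shows "card (vec.span B) = CARD('a) ^ card B"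
  using finite[of B] assms
proof (induction B rule: finite_induct)
  case (insert b B)
  then have "b \<notin> vec.span B" "vec.independent B"
    by (auto simp: vec.independent_insert)
  then show ?case using insert by (simp add: card_span_insert)
qed (simp add: vec.span_empty)

lemma card_subspace:
  fixes S :: "('a::{field,finite} ^ 'm) set"
  assumes "vec.subspace S"
  shows "card S = CARD('a) ^ vec.dim S"
proof -
  obtain B where "B \<subseteq> S" "vec.independent B" "S \<subseteq> vec.span B" "card B = vec.dim S"
    using vec.basis_exists .
  then have "vec.span B = S" using assms by (simp add: vec.span_subspace)
  then show ?thesis
    using card_span_independent[OF \<open>vec.independent B\<close>] \<open>card B = vec.dim S\<close> by simp
qed

lemma card_proper_subspace_le:
  fixes S T :: "('a::{field,finite} ^ 'm) set"
  assumes "vec.subspace S" "vec.subspace T" "T \<subset> S"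
  shows "CARD('a) * card T \<le> card S"
proof -
  obtain b where b: "b \<in> S" "b \<notin> T" using assms by auto
  have T: "vec.span T = T" using assms by simp
  have "vec.span (insert b T) \<subseteq> S"
    using assms b by (intro vec.span_minimal) auto
  then have "card (vec.span (insert b T)) \<le> card S" by (intro card_mono) auto
  then show ?thesis using card_span_insert[of b T] b T by simp
qed

text \<open>The \<open>CARD('a) - 1\<close> translates of \<open>T\<close> by nonzero multiples of
  \<open>u\<close> cover \<open>S\<close>. In the uses below, \<open>S\<close> avoids a hyperplane
  that contains \<open>T\<close>, and this is what excludes \<open>c = 0\<close>.\<close>

lemma card_le_nonzero_translates:
  fixes S T :: "('a::{field,finite} ^ 'm) set"
  assumes "\<And>s. s \<in> S \<Longrightarrow> \<exists>c. c \<noteq> 0 \<and> s - c *s u \<in> T"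
  shows "card S \<le> (CARD('a) - 1) * card T"
proof -
  have "S \<subseteq> (\<lambda>(c, t). c *s u + t) ` ((UNIV - {0}) \<times> T)"
  proof
    fix s assume "s \<in> S"
    then obtain c where "c \<noteq> 0" "s - c *s u \<in> T" using assms by blast
    then show "s \<in> (\<lambda>(c, t). c *s u + t) ` ((UNIV - {0}) \<times> T)"
      by (intro image_eqI[of _ _ "(c, s - c *s u)"]) auto
  qed
  then have "card S \<le> card ((UNIV - {0 :: 'a}) \<times> T)"
    by (rule surj_card_le[rotated]) simp
  then show ?thesis by (simp add: card_cartesian_product card_Diff_singleton)
qed

text \<open>The intersection with \<open>T\<close> is a proper subspace of \<open>S\<close>, so it
  takes up at most the fraction \<open>1 / CARD('a)\<close> of \<open>S\<close>.\<close>

lemma card_Diff_subspace_ge: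
  fixes S T :: "('a::{field,finite} ^ 'm) set"
  assumes "vec.subspace S" "vec.subspace T" "S - T \<noteq> {}"
  shows "(CARD('a) - 1) * card S \<le> CARD('a) * card (S - T)"
proof -
  have "vec.subspace (S \<inter> T)" "S \<inter> T \<subset> S" using assms by (auto intro: vec.subspace_inter)
  then have "CARD('a) * card (S \<inter> T) \<le> card S"
    using assms card_proper_subspace_le by blast
  moreover have "card (S - T) = card S - card (S \<inter> T)"
    using card_Diff_subset_Int[of S T] by simp
  ultimately show ?thesis
    by (simp add: diff_mult_distrib diff_mult_distrib2)
qed

section \<open>Independent families of vectors\<close>

text \<open>The space \<open>H j\<close> of the overview. It is independent of \<open>x j\<close>,
  so tuples that agree off \<open>j\<close> share it.\<close>

definition hull_without :: "nat \<Rightarrow> (nat \<Rightarrow> 'a::field ^ 'm) \<Rightarrow> nat \<Rightarrow> ('a ^ 'm) set" where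
  "hull_without n x j = vec.span (x ` ({1..n} - {j}))"

text \<open>Independence of the indexed family: a repeated vector makes it fail, whereas
  \<open>vec.independent\<close> of the image set would not notice the repetition.\<close>

definition indep_family :: "nat \<Rightarrow> (nat \<Rightarrow> 'a::field ^ 'm) \<Rightarrow> bool" where
  "indep_family n x \<longleftrightarrow> (\<forall>j\<in>{1..n}. x j \<notin> hull_without n x j)"

lemma hull_without_upd [simp]: "hull_without n (x(j := v)) j = hull_without n x j"
  unfolding hull_without_def by (rule arg_cong[where f = vec.span]) auto

lemma subspace_hull_without [simp]: "vec.subspace (hull_without n x j)"
  by (simp add: hull_without_def)

lemma indep_family_inj:
  assumes "indep_family n x"
  shows "inj_on x {1..n}"
proof (rule inj_onI, rule ccontr)
  fix i j assume ij: "i \<in> {1..n}" "j \<in> {1..n}" "x i = x j" "i \<noteq> j"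
  then have "x i \<in> x ` ({1..n} - {i})" by auto
  then have "x i \<in> hull_without n x i" unfolding hull_without_def by (rule vec.span_base)
  then show False using assms ij(1) by (simp add: indep_family_def)
qed

lemma indep_family_image_Diff:
  assumes "indep_family n x" "j \<in> {1..n}"
  shows "x ` ({1..n} - {j}) = x ` {1..n} - {x j}"
  using inj_on_image_set_diff[OF indep_family_inj[OF assms(1)], of "{1..n}" "{j}"] assms(2) by auto

lemma indep_family_independent:
  assumes "indep_family n x"
  shows "vec.independent (x ` {1..n})"
  unfolding vec.dependent_def
proof clarify
  fix j assume j: "j \<in> {1..n}" and "x j \<in> vec.span (x ` {1..n} - {x j})"
  then have "x j \<in> hull_without n x j"
    using indep_family_image_Diff[OF assms j] by (simp add: hull_without_def)
  then show False using assms j by (simp add: indep_family_def)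
qed

lemma indep_family_span:
  fixes x :: "nat \<Rightarrow> 'a::field ^ 'm"
  assumes "indep_family n x" "x ` {1..n} \<subseteq> U" "vec.subspace U" "vec.dim U = n"
  shows "vec.span (x ` {1..n}) = U"
proof -
  have "card (x ` {1..n}) = n" using card_image[OF indep_family_inj[OF assms(1)]] by simp
  then have "U \<subseteq> vec.span (x ` {1..n})"
    using vec.card_eq_dim[OF assms(2)] indep_family_independent[OF assms(1)] assms(4) by simp
  then show ?thesis using assms by (simp add: vec.span_subspace)
qed

text \<open>An independent family of \<open>n\<close> vectors spans the \<open>n\<close>-dimensional
  space \<open>U\<close>, so the hull at \<open>j\<close> is a hyperplane of \<open>U\<close> with
  the line of \<open>x j\<close> as a complement.\<close>

lemma hull_without_complement:
  assumes "indep_family n x" "x ` {1..n} \<subseteq> U" "vec.subspace U" "vec.dim U = n" "j \<in> {1..n}" "u \<in> U"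
  shows "\<exists>c. u - c *s x j \<in> hull_without n x j"
proof -
  have "x ` {1..n} = insert (x j) (x ` ({1..n} - {j}))" using assms(5) by auto
  then have "u \<in> vec.span (insert (x j) (x ` ({1..n} - {j})))"
    using indep_family_span[OF assms(1-4)] assms(6) by simp
  then show ?thesis by (simp add: vec.span_breakdown_eq hull_without_def)
qed

text \<open>Adjoining the vectors in order keeps the set independent at every step. The
  contrapositive provides, for a dependent tuple, an entry lying in the span of its predecessors,
  which is easy to count.\<close>

lemma indep_familyI_triangular:
  fixes x :: "nat \<Rightarrow> 'a::field ^ 'm"
  assumes "\<And>j. j \<in> {1..n} \<Longrightarrow> x j \<notin> vec.span (x ` {1..<j})"
  shows "indep_family n x"
proof -
  have "vec.independent (x ` {1..k}) \<and> inj_on x {1..k}" if "k \<le> n" for k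
    using that
  proof (induction k)
    case (Suc k)
    have set: "{1..Suc k} = insert (Suc k) {1..k}" "{1..<Suc k} = {1..k}" by auto
    have "x (Suc k) \<notin> vec.span (x ` {1..k})" using assms[of "Suc k"] Suc.prems set by simp
    moreover from this have "x (Suc k) \<notin> x ` {1..k}" by (meson vec.span_base)
    ultimately show ?case using Suc.IH Suc.prems
      by (simp only: set image_insert vec.independent_insert) simp
  qed (simp add: vec.independent_empty)
  then have ind: "vec.independent (x ` {1..n})" and inj: "inj_on x {1..n}" by auto
  show ?thesis unfolding indep_family_def hull_without_def
  proof
    fix j assume j: "j \<in> {1..n}"
    have "x ` ({1..n} - {j}) = x ` {1..n} - {x j}"
      using inj_on_image_set_diff[OF inj, of "{1..n}" "{j}"] j by auto
    then show "x j \<notin> vec.span (x ` ({1..n} - {j}))"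
      using ind j unfolding vec.dependent_def by (metis imageI)
  qed
qed

section \<open>Linear functionals on a subspace\<close>

text \<open>A linear functional on \<open>U\<close> is extended by 0 outside \<open>U\<close>.\<close>

definition functionals_on :: "('a::field ^ 'm) set \<Rightarrow> ('a ^ 'm \<Rightarrow> 'a) set" where
  "functionals_on U = {g. (\<forall>v. v \<notin> U \<longrightarrow> g v = 0) \<and>
     (\<forall>u\<in>U. \<forall>v\<in>U. g (u + v) = g u + g v) \<and> (\<forall>c. \<forall>v\<in>U. g (c *s v) = c * g v)}"

lemma functionals_on_eq_subspace:
  assumes "g \<in> functionals_on U" "h \<in> functionals_on U" "vec.subspace U"
  shows "vec.subspace {v \<in> U. g v = h v}"
proof (rule vec.subspaceI)
  have "g (0 *s 0) = 0 * g 0" "h (0 *s 0) = 0 * h 0"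
    using assms vec.subspace_0[OF assms(3)] unfolding functionals_on_def by blast+
  then show "0 \<in> {v \<in> U. g v = h v}"
    using vec.subspace_0[OF assms(3)] by simp
next
  fix u v assume "u \<in> {v \<in> U. g v = h v}" "v \<in> {v \<in> U. g v = h v}"
  then show "u + v \<in> {v \<in> U. g v = h v}"
    using assms vec.subspace_add[OF assms(3)] by (simp add: functionals_on_def)
next
  fix c v assume "v \<in> {v \<in> U. g v = h v}"
  then show "c *s v \<in> {v \<in> U. g v = h v}"
    using assms vec.subspace_scale[OF assms(3)] by (simp add: functionals_on_def)
qed

lemma zero_functional: "(\<lambda>_. 0) \<in> functionals_on U"
  by (simp add: functionals_on_def)

lemma functionals_on_eq_span:
  assumes "g \<in> functionals_on U" "h \<in> functionals_on U" "vec.subspace U"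
    and "B \<subseteq> U" "\<And>b. b \<in> B \<Longrightarrow> g b = h b" "v \<in> vec.span B"
  shows "g v = h v"
proof -
  have "B \<subseteq> {v \<in> U. g v = h v}" using assms(4,5) by auto
  then have "vec.span B \<subseteq> {v \<in> U. g v = h v}"
    using functionals_on_eq_subspace[OF assms(1-3)] by (rule vec.span_minimal)
  then show ?thesis using assms(6) by auto
qed

text \<open>By \<open>cardE\<close>, \<open>F\<close> is a hyperplane of \<open>E\<close>. Extend a
  basis \<open>B\<close> of \<open>F\<close> by one vector \<open>e\<close> to a basis of
  \<open>E\<close>, and further to a basis \<open>C\<close> of \<open>U\<close>. A functional of the
  given kind is 0 on \<open>B\<close>, nonzero at \<open>e\<close> and arbitrary on the rest of
  \<open>C\<close>. The number of choices times \<open>card E\<close>, a power with exponent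
  \<open>card (insert e B)\<close>, is \<open>(CARD('a) - 1) * card U\<close>.\<close>

lemma card_functionals_le:
  fixes E F U :: "('a::{field,finite} ^ 'm) set"
  assumes sub: "vec.subspace E" "vec.subspace F" "vec.subspace U" and "F \<subset> E" "E \<subseteq> U"
    and cardE: "card E = CARD('a) * card F"
  shows "card {g \<in> functionals_on U. (\<forall>v\<in>F. g v = 0) \<and> (\<exists>v\<in>E. g v \<noteq> 0)} * card E
    \<le> (CARD('a) - 1) * card U"
proof -
  let ?G = "{g \<in> functionals_on U. (\<forall>v\<in>F. g v = 0) \<and> (\<exists>v\<in>E. g v \<noteq> 0)}"
  obtain B where B: "B \<subseteq> F" "vec.independent B" "F \<subseteq> vec.span B"
    using vec.maximal_independent_subset .
  have spanB: "vec.span B = F" using B sub by (simp add: vec.span_subspace)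
  obtain e where e: "e \<in> E" "e \<notin> F" using \<open>F \<subset> E\<close> by auto
  have eB: "e \<notin> B" using B e by auto
  have indB': "vec.independent (insert e B)"
    using B e spanB by (simp add: vec.independent_insertI)
  have B'sub: "insert e B \<subseteq> E" using B e \<open>F \<subset> E\<close> by auto
  then have "vec.span (insert e B) \<subseteq> E" using sub by (simp add: vec.span_minimal)
  moreover have "card (vec.span (insert e B)) = card E"
    using card_span_insert[of e B] e spanB cardE by simp
  ultimately have spanB': "vec.span (insert e B) = E" by (simp add: card_subset_eq)
  obtain C where C: "insert e B \<subseteq> C" "C \<subseteq> U" "vec.independent C" "U \<subseteq> vec.span C"
    using vec.maximal_independent_subset_extend[of "insert e B" U] indB' B'sub \<open>E \<subseteq> U\<close> by blast
  have spanC: "vec.span C = U" using C sub by (simp add: vec.span_subspace)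
  let ?r = "\<lambda>g. restrict g (C - B)"
  have inj: "inj_on ?r ?G"
  proof (rule inj_onI)
    fix g h assume g: "g \<in> ?G" and h: "h \<in> ?G" and eq: "?r g = ?r h"
    have "g b = h b" if "b \<in> C" for b
    proof (cases "b \<in> B")
      case True then show ?thesis using g h B by auto
    next
      case False then show ?thesis using fun_cong[OF eq, of b] that by simp
    qed
    then have "g v = h v" if "v \<in> U" for v
      using functionals_on_eq_span[of g U h C v] g h sub C spanC that by blast
    moreover have "g v = h v" if "v \<notin> U" for v
      using g h that by (simp add: functionals_on_def)
    ultimately show "g = h" by blast
  qed
  have "?r ` ?G \<subseteq> (\<Pi>\<^sub>E b\<in>C - B. if b = e then UNIV - {0} else UNIV)"
  proof (rule image_subsetI)
    fix g assume "g \<in> ?G"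
    then obtain v where g: "g \<in> functionals_on U" "\<forall>v\<in>F. g v = 0" and v: "v \<in> E" "g v \<noteq> 0"
      by blast
    have "g e \<noteq> 0"
    proof
      assume "g e = 0"
      then have "g b = 0" if "b \<in> insert e B" for b using that g B by auto
      then have "g v = 0"
        using functionals_on_eq_span[OF g(1) zero_functional sub(3), of "insert e B" v]
          B'sub \<open>E \<subseteq> U\<close> spanB' v by auto
      then show False using v by simp
    qed
    then show "?r g \<in> (\<Pi>\<^sub>E b\<in>C - B. if b = e then UNIV - {0} else UNIV)" by auto
  qed
  then have "card (?r ` ?G) \<le> card (\<Pi>\<^sub>E b\<in>C - B. if b = e then UNIV - {0 :: 'a} else UNIV)"
    by (rule card_mono[rotated]) (auto intro!: finite_PiE)
  also have "\<dots> = (\<Prod>b\<in>insert e (C - insert e B). card (if b = e then UNIV - {0 :: 'a} else UNIV))"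
  proof -
    have "C - B = insert e (C - insert e B)" using C eB by auto
    then show ?thesis by (simp only: card_PiE[OF finite])
  qed
  also have "\<dots> = (CARD('a) - 1) * (\<Prod>b\<in>C - insert e B. CARD('a))"
    by (subst prod.insert) (auto simp: card_Diff_singleton intro!: prod.cong)
  also have "\<dots> = (CARD('a) - 1) * CARD('a) ^ (card C - card (insert e B))"
    using C by (simp add: card_Diff_subset)
  finally have "card ?G \<le> (CARD('a) - 1) * CARD('a) ^ (card C - card (insert e B))"
    by (simp add: card_image[OF inj])
  then have "card ?G * card E
      \<le> (CARD('a) - 1) * CARD('a) ^ (card C - card (insert e B)) * CARD('a) ^ card (insert e B)"
    using card_span_independent[OF indB'] spanB' by simp
  also have "\<dots> = (CARD('a) - 1) * CARD('a) ^ card C"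
    using card_mono[OF finite C(1)] by (simp add: power_add[symmetric] mult.assoc)
  finally show ?thesis
    using card_span_independent[OF C(3)] spanC by simp
qed

section \<open>Charging independent tuples to dependent ones\<close>

text \<open>A nonempty part after passing to nonzero vectors: \<open>U\<close> is the linear space
  of the flat \<open>L\<close>, and \<open>E j - F j\<close> is the lift of the \<open>j\<close>-th
  factor. Proper inclusion says that the factor is nonempty.\<close>

locale subspace_difference_product =
  fixes n :: nat
    and U :: "('a::{field,finite} ^ 'm) set"
    and E F :: "nat \<Rightarrow> ('a ^ 'm) set"
  assumes subspace_U: "vec.subspace U"
    and dim_U: "vec.dim U = n"
    and subspace_E: "\<And>j. j \<in> {1..n} \<Longrightarrow> vec.subspace (E j)"
    and subspace_F: "\<And>j. j \<in> {1..n} \<Longrightarrow> vec.subspace (F j)"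
    and E_subset_U: "\<And>j. j \<in> {1..n} \<Longrightarrow> E j \<subseteq> U"
    and F_psubset_E: "\<And>j. j \<in> {1..n} \<Longrightarrow> F j \<subset> E j"
begin

definition A :: "(nat \<Rightarrow> 'a ^ 'm) set" where
  "A = (\<Pi>\<^sub>E j\<in>{1..n}. E j - F j)"

definition gen :: "(nat \<Rightarrow> 'a ^ 'm) set" where
  "gen = {x \<in> A. indep_family n x}"

definition dep :: "(nat \<Rightarrow> 'a ^ 'm) set" where
  "dep = {x \<in> A. \<not> indep_family n x}"

text \<open>The values to which \<open>x j\<close> can be moved, within its factor, so that the
  tuple becomes dependent at \<open>j\<close>.\<close>

definition swaps :: "(nat \<Rightarrow> 'a ^ 'm) \<Rightarrow> nat \<Rightarrow> ('a ^ 'm) set" where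
  "swaps x j = (E j - F j) \<inter> hull_without n x j"

definition degenerable :: "(nat \<Rightarrow> 'a ^ 'm) \<Rightarrow> nat set" where
  "degenerable x = {j \<in> {1..n}. swaps x j \<noteq> {}}"

definition rigid :: "(nat \<Rightarrow> 'a ^ 'm) set" where
  "rigid = {x \<in> gen. degenerable x = {}}"

text \<open>The tuples that are charged to \<open>z\<close> through the index \<open>j\<close>.\<close>

definition charging :: "(nat \<Rightarrow> 'a ^ 'm) \<Rightarrow> nat \<Rightarrow> (nat \<Rightarrow> 'a ^ 'm) set" where
  "charging z j = {x \<in> gen - rigid. Min (degenerable x) = j \<and> (\<exists>v. x = z(j := v)) \<and>
     z j \<in> hull_without n z j}"

lemma finite_A [simp]: "finite A"
  unfolding A_def by (intro finite_PiE) auto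

lemma finite_subsets [simp]: "finite gen" "finite dep" "finite rigid" "finite (charging z j)"
  unfolding gen_def dep_def rigid_def charging_def by simp_all

lemma A_memD:
  assumes "x \<in> A" "j \<in> {1..n}"
  shows "x j \<in> E j" "x j \<notin> F j" "x j \<in> U"
  using assms E_subset_U[of j] unfolding A_def by (auto dest!: PiE_mem[of _ _ _ j])

lemma image_subset_U: "x \<in> A \<Longrightarrow> x ` {1..n} \<subseteq> U"
  using A_memD(3) by blast

lemma gen_complement:
  assumes "x \<in> gen" "j \<in> {1..n}" "u \<in> U"
  shows "\<exists>c. u - c *s x j \<in> hull_without n x j"
  using hull_without_complement[OF _ image_subset_U subspace_U dim_U assms(2,3)] assms(1)
  by (simp add: gen_def)

lemma swaps_upd [simp]: "swaps (x(j := v)) j = swaps x j"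
  by (simp add: swaps_def)

lemma card_swaps_ge:
  assumes "j \<in> {1..n}" "swaps x j \<noteq> {}"
  shows "(CARD('a) - 1) * card (E j \<inter> hull_without n x j) \<le> CARD('a) * card (swaps x j)"
proof -
  have "swaps x j = E j \<inter> hull_without n x j - F j" by (auto simp: swaps_def)
  then show ?thesis
    using card_Diff_subspace_ge[of "E j \<inter> hull_without n x j" "F j"] assms
    by (simp add: subspace_E subspace_F vec.subspace_inter)
qed

text \<open>As \<open>x\<close> and \<open>z\<close> agree off \<open>j\<close>, they have the same
  hull and the same \<open>swaps\<close> at \<open>j\<close>. The clause on \<open>i < j\<close> is
  the minimality of \<open>j\<close> in \<open>degenerable x\<close>.\<close>

lemma chargingD:
  assumes "x \<in> charging z j"
  shows "x \<in> gen" "x = z(j := x j)" "j \<in> {1..n}" "swaps z j \<noteq> {}" "x j \<notin> hull_without n z j"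
    "hull_without n x j = hull_without n z j"
    "\<And>i. i \<in> {1..n} \<Longrightarrow> i < j \<Longrightarrow> swaps x i = {}" "z j \<in> hull_without n z j"
proof -
  obtain v where v: "x = z(j := v)" and x: "x \<in> gen" "x \<notin> rigid" "Min (degenerable x) = j"
    and z: "z j \<in> hull_without n z j"
    using assms by (auto simp: charging_def)
  have fin: "finite (degenerable x)" by (simp add: degenerable_def)
  have "degenerable x \<noteq> {}" using x by (auto simp: rigid_def)
  then have "j \<in> degenerable x" using Min_in[OF fin] x by simp
  then show j: "j \<in> {1..n}" and "swaps z j \<noteq> {}" by (auto simp: degenerable_def v)
  show "x \<in> gen" "x = z(j := x j)" using x v by auto
  show H: "hull_without n x j = hull_without n z j" using v by simp
  show "x j \<notin> hull_without n z j" using x(1) j H unfolding gen_def indep_family_def by blast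
  show "swaps x i = {}" if "i \<in> {1..n}" "i < j" for i
  proof (rule ccontr)
    assume "swaps x i \<noteq> {}"
    then have "i \<in> degenerable x" using that by (simp add: degenerable_def)
    then show False using Min_le[OF fin, of i] x(3) that by simp
  qed
  show "z j \<in> hull_without n z j" using z .
qed

lemma card_charging: "card (charging z j) = card ((\<lambda>x. x j) ` charging z j)"
proof (rule card_image[symmetric], rule inj_onI)
  fix x y assume "x \<in> charging z j" "y \<in> charging z j" "x j = y j"
  then show "x = y" using chargingD(2)[of x z j] chargingD(2)[of y z j] by metis
qed

lemma gen_E: "x \<in> gen \<Longrightarrow> j \<in> {1..n} \<Longrightarrow> x j \<in> E j"
  using A_memD by (simp add: gen_def)

text \<open>All tuples charged to \<open>z\<close> through \<open>j\<close> have their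
  \<open>j\<close>-th entry in \<open>E j\<close> but off the hyperplane
  \<open>hull_without n z j\<close>. Relative to one such entry \<open>y j\<close>, the others are
  nonzero translates over the intersection of \<open>E j\<close> with this hyperplane, and
  \<open>swaps z j\<close> fills at least the fraction \<open>(q - 1) / q\<close> of that
  intersection, where \<open>q = CARD('a)\<close>.\<close>

lemma card_charging_le:
  assumes "charging z j \<noteq> {}"
  shows "card (charging z j) \<le> CARD('a) * card (swaps z j)"
proof -
  obtain y where y: "y \<in> charging z j" using assms by blast
  note Y = chargingD[OF y]
  have "card ((\<lambda>x. x j) ` charging z j) \<le> (CARD('a) - 1) * card (E j \<inter> hull_without n z j)"
  proof (rule card_le_nonzero_translates[where u = "y j"])
    fix s assume "s \<in> (\<lambda>x. x j) ` charging z j"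
    then obtain x where x: "x \<in> charging z j" "s = x j" by blast
    note X = chargingD[OF x(1)]
    have sE: "s \<in> E j" "y j \<in> E j" using gen_E X Y x by auto
    then obtain c where c: "s - c *s y j \<in> hull_without n z j"
      using gen_complement[OF Y(1,3), of s] E_subset_U[OF Y(3)] Y(6) by auto
    moreover have "c \<noteq> 0" using c X(5) x(2) by auto
    moreover have "s - c *s y j \<in> E j"
      using sE subspace_E[OF Y(3)] by (simp add: vec.subspace_diff vec.subspace_scale)
    ultimately show "\<exists>c. c \<noteq> 0 \<and> s - c *s y j \<in> E j \<inter> hull_without n z j" by blast
  qed
  also have "\<dots> \<le> CARD('a) * card (swaps z j)" using card_swaps_ge Y(3,4) by blast
  finally show ?thesis by (simp add: card_charging)
qed

lemma hull_split:
  assumes "i \<in> {1..n}" "i \<noteq> j"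
  shows "hull_without n z j = vec.span (insert (z i) (z ` ({1..n} - {i, j})))"
proof -
  have "{1..n} - {j} = insert i ({1..n} - {i, j})" using assms by auto
  then show ?thesis unfolding hull_without_def by (metis image_insert)
qed

text \<open>
  Since \<open>i\<close> was not used for \<open>x\<close>, the set \<open>E i - F i\<close> misses the hyperplane spanned by
  \<open>W\<close> and \<open>x j\<close>. That hyperplane is therefore spanned by \<open>W\<close> and \<open>F i\<close>, and all
  \<open>x\<close> charged to \<open>z\<close> through \<open>j\<close> have \<open>x j\<close> in it.
\<close>

lemma charging_second_index:
  assumes z: "z \<in> A" and y: "y \<in> charging z i" and x: "x \<in> charging z j" and "i < j"
  defines "W \<equiv> z ` ({1..n} - {i, j})"
  shows "F i \<subseteq> vec.span (insert (x j) W)" "x j \<in> vec.span (F i \<union> W)"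
proof -
  note X = chargingD[OF x] and Y = chargingD[OF y]
  have i: "i \<in> {1..n}" and j: "j \<in> {1..n}" using X(3) Y(3) by auto
  have xi: "x i = z i" using X(2) \<open>i < j\<close> by (metis fun_upd_other less_irrefl)
  have "x ` ({1..n} - {i, j}) = W"
    unfolding W_def by (subst X(2)) auto
  then have Hx: "hull_without n x i = vec.span (insert (x j) W)"
    using hull_split[OF j, of i x] \<open>i < j\<close> by (simp add: insert_commute)
  have Hz: "hull_without n z i = vec.span (insert (z j) W)"
    using hull_split[OF j, of i z] \<open>i < j\<close> by (simp add: insert_commute W_def)
  have empty: "E i \<inter> hull_without n x i \<subseteq> F i"
    using X(7)[OF i \<open>i < j\<close>] by (auto simp: swaps_def)
  have zE: "z i \<in> E i" "z i \<notin> F i" using A_memD[OF z i] by auto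
  have yE: "y i \<in> E i" using gen_E[OF Y(1) i] .
  have subE: "vec.subspace (E i)" and subF: "vec.subspace (F i)"
    using subspace_E subspace_F i by auto
  have FE: "F i \<subseteq> E i" using F_psubset_E[OF i] by auto
  show "F i \<subseteq> vec.span (insert (x j) W)"
  proof
    fix f assume f: "f \<in> F i"
    then obtain c where c: "f - c *s z i \<in> hull_without n x i"
      using gen_complement[OF X(1) i, of f] xi FE E_subset_U[OF i] by auto
    have "f - c *s z i \<in> E i"
      using f FE zE subE by (auto intro!: vec.subspace_diff vec.subspace_scale)
    then have "f - c *s z i \<in> F i" using c empty by blast
    then have cz: "c *s z i \<in> F i"
      using vec.subspace_diff[OF subF f] by fastforce
    have "c = 0"
    proof (rule ccontr)
      assume "c \<noteq> 0"
      then have "z i = inverse c *s (c *s z i)" by simp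
      then show False using vec.subspace_scale[OF subF cz] zE(2) by metis
    qed
    then show "f \<in> vec.span (insert (x j) W)" using c Hx by simp
  qed
  \<comment> \<open>The vector \<open>y i - c *s z i\<close> lies in \<open>F i\<close> and equals
    \<open>d *s x j\<close> modulo \<open>vec.span W\<close>. Once \<open>d\<close> is known to be
    nonzero, it can be solved for \<open>x j\<close>.\<close>
  obtain c where c: "y i - c *s z i \<in> hull_without n x i"
    using gen_complement[OF X(1) i, of "y i"] xi yE E_subset_U[OF i] by auto
  have "y i - c *s z i \<in> E i"
    using yE zE subE by (auto intro!: vec.subspace_diff vec.subspace_scale)
  then have kF: "y i - c *s z i \<in> F i" using c empty by blast
  obtain d where d: "y i - c *s z i - d *s x j \<in> vec.span W"
    using c unfolding Hx vec.span_breakdown_eq by blast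
  have "d \<noteq> 0"
  proof
    assume "d = 0"
    then have "y i - c *s z i \<in> vec.span W" using d by simp
    then have "y i - c *s z i \<in> hull_without n z i"
      unfolding Hz using vec.span_mono[of W "insert (z j) W"] by blast
    then have "(y i - c *s z i) + c *s z i \<in> hull_without n z i"
      using Y(8) by (intro vec.subspace_add vec.subspace_scale) auto
    then show False using Y(5) by simp
  qed
  have "y i - c *s z i \<in> vec.span (F i \<union> W)" using kF by (intro vec.span_base) auto
  moreover have "y i - c *s z i - d *s x j \<in> vec.span (F i \<union> W)"
    using d vec.span_mono[of W "F i \<union> W"] by blast
  ultimately have "(y i - c *s z i) - (y i - c *s z i - d *s x j) \<in> vec.span (F i \<union> W)"
    by (rule vec.span_diff)
  then have "d *s x j \<in> vec.span (F i \<union> W)" by simp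
  then have "inverse d *s (d *s x j) \<in> vec.span (F i \<union> W)" by (rule vec.span_scale)
  then show "x j \<in> vec.span (F i \<union> W)" using \<open>d \<noteq> 0\<close> by simp
qed

text \<open>By \<open>charging_second_index\<close>, all entries \<open>x j\<close> lie in the
  single space spanned by \<open>x1 j\<close> and \<open>W\<close>. They are therefore nonzero
  translates over \<open>E j \<inter> vec.span W\<close>, a proper subspace of the intersection used
  in \<open>card_charging_le\<close>; this gains the factor \<open>CARD('a)\<close>.\<close>

lemma card_charging_le_second:
  assumes z: "z \<in> A" and "charging z i \<noteq> {}" and "charging z j \<noteq> {}" and "i < j"
  shows "card (charging z j) \<le> card (swaps z j)"
proof -
  obtain y where y: "y \<in> charging z i" using assms by blast
  obtain x1 where x1: "x1 \<in> charging z j" using assms by blast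
  note Y = chargingD[OF y] and X1 = chargingD[OF x1]
  define W where "W = z ` ({1..n} - {i, j})"
  have i: "i \<in> {1..n}" and j: "j \<in> {1..n}" using X1(3) Y(3) by auto
  have subE: "vec.subspace (E j)" using subspace_E j .
  have Hj: "hull_without n z j = vec.span (insert (z i) W)"
    using hull_split[OF i, of j z] \<open>i < j\<close> by (simp add: W_def)
  have WH: "vec.span W \<subseteq> hull_without n z j" unfolding Hj by (rule vec.span_mono) auto
  let ?T = "E j \<inter> vec.span W"
  have subT: "vec.subspace ?T" using subE by (simp add: vec.subspace_inter)
  have X: "card ((\<lambda>x. x j) ` charging z j) \<le> (CARD('a) - 1) * card ?T"
  proof (rule card_le_nonzero_translates[where u = "x1 j"])
    fix s assume "s \<in> (\<lambda>x. x j) ` charging z j"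
    then obtain x where x: "x \<in> charging z j" "s = x j" by blast
    note X = chargingD[OF x(1)]
    have sE: "s \<in> E j" "x1 j \<in> E j" using gen_E X X1 x by auto
    have "F i \<union> W \<subseteq> vec.span (insert (x1 j) W)"
      using charging_second_index(1)[OF z y x1 \<open>i < j\<close>] vec.span_superset[of "insert (x1 j) W"]
      unfolding W_def by simp
    then have "vec.span (F i \<union> W) \<subseteq> vec.span (insert (x1 j) W)"
      by (rule vec.span_minimal) simp
    then have "s \<in> vec.span (insert (x1 j) W)"
      using charging_second_index(2)[OF z y x(1) \<open>i < j\<close>] x(2) unfolding W_def by blast
    then obtain c where c: "s - c *s x1 j \<in> vec.span W"
      unfolding vec.span_breakdown_eq by blast
    moreover have "c \<noteq> 0" using c X(5) x(2) WH by auto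
    moreover have "s - c *s x1 j \<in> E j"
      using sE subE by (simp add: vec.subspace_diff vec.subspace_scale)
    ultimately show "\<exists>c. c \<noteq> 0 \<and> s - c *s x1 j \<in> ?T" by blast
  qed
  have T: "CARD('a) * card ?T \<le> card (E j \<inter> hull_without n z j)"
  proof (rule card_proper_subspace_le)
    show "vec.subspace (E j \<inter> hull_without n z j)" using subE by (simp add: vec.subspace_inter)
    \<comment> \<open>The vector \<open>z j\<close> witnesses properness: it lies in the hull at
      \<open>j\<close> because \<open>z\<close> is charged through \<open>j\<close>, and outside
      \<open>vec.span W\<close> because the independent tuple \<open>y\<close> agrees with
      \<open>z\<close> off \<open>i\<close>.\<close>
    have yj: "y j = z j" using Y(2) \<open>i < j\<close> by (metis fun_upd_other less_irrefl)
    have "W = y ` ({1..n} - {i, j})"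
      unfolding W_def by (subst Y(2)) auto
    then have "vec.span W \<subseteq> hull_without n y j"
      unfolding hull_without_def by (intro vec.span_mono) auto
    moreover have "y j \<notin> hull_without n y j"
      using Y(1) j unfolding gen_def indep_family_def by blast
    ultimately have "z j \<notin> vec.span W" using yj by auto
    moreover have "z j \<in> E j \<inter> hull_without n z j"
      using A_memD[OF z j] X1(8) by simp
    ultimately show "?T \<subset> E j \<inter> hull_without n z j" using WH by blast
  qed (rule subT)
  have "CARD('a) * card ((\<lambda>x. x j) ` charging z j) \<le> (CARD('a) - 1) * (CARD('a) * card ?T)"
    using mult_le_mono2[OF X, of "CARD('a)"] by (simp only: mult.left_commute)
  also have "\<dots> \<le> (CARD('a) - 1) * card (E j \<inter> hull_without n z j)"
    using T by (rule mult_le_mono2)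
  also have "\<dots> \<le> CARD('a) * card (swaps z j)"
    using card_swaps_ge X1(3,4) by blast
  finally show ?thesis by (simp add: card_charging)
qed

end

section \<open>Double counting of the charges\<close>

context subspace_difference_product
begin

text \<open>For the least degenerable index \<open>j\<close>, the tuple \<open>x\<close> gives the
  share \<open>1 / card (swaps x j)\<close> to each of the \<open>card (swaps x j)\<close> tuples
  \<open>x(j := p)\<close>. Moving the entry at \<open>j\<close> leaves \<open>swaps\<close> at
  \<open>j\<close> unchanged, so these shares add up to 1.\<close>

lemma charging_weight_ge_1:
  assumes x: "x \<in> gen - rigid"
  shows "1 \<le> (\<Sum>z\<in>dep. \<Sum>j\<in>{1..n}. if x \<in> charging z j then 1 / real (card (swaps z j)) else 0)"
proof -
  define j where "j = Min (degenerable x)"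
  have fin: "finite (degenerable x)" by (simp add: degenerable_def)
  have "degenerable x \<noteq> {}" using x by (auto simp: rigid_def)
  then have jx: "j \<in> degenerable x" using Min_in[OF fin] unfolding j_def by blast
  then have j: "j \<in> {1..n}" and ne: "swaps x j \<noteq> {}" by (auto simp: degenerable_def)
  have xA: "x \<in> A" using x by (simp add: gen_def)
  define Z where "Z = (\<lambda>p. x(j := p)) ` swaps x j"
  have cardZ: "card Z = card (swaps x j)"
    unfolding Z_def by (rule card_image) (rule inj_onI, metis fun_upd_same)
  have Z: "z \<in> dep" "x \<in> charging z j" "swaps z j = swaps x j" if zZ: "z \<in> Z" for z
  proof -
    obtain p where p: "p \<in> swaps x j" "z = x(j := p)" using zZ by (auto simp: Z_def)
    have zj: "z j \<in> hull_without n z j" using p by (simp add: swaps_def)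
    have "z \<in> A"
      unfolding A_def
    proof (rule PiE_I)
      fix i assume "i \<in> {1..n}"
      then show "z i \<in> E i - F i" using p A_memD[OF xA] by (auto simp: swaps_def)
    next
      fix i assume "i \<notin> {1..n}"
      then show "z i = undefined" using p(2) j PiE_arb[OF xA[unfolded A_def]] by auto
    qed
    then show "z \<in> dep" using zj j unfolding dep_def indep_family_def by blast
    have "x = z(j := x j)" using p(2) by simp
    then show "x \<in> charging z j" using x zj unfolding charging_def j_def by blast
    show "swaps z j = swaps x j" using p(2) by simp
  qed
  have "1 = (\<Sum>z\<in>Z. 1 / real (card (swaps z j)))"
    using Z(3) cardZ ne by simp
  also have "\<dots> = (\<Sum>z\<in>Z. if x \<in> charging z j then 1 / real (card (swaps z j)) else 0)"
    using Z(2) by simp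
  also have "\<dots> \<le> (\<Sum>z\<in>Z. \<Sum>j\<in>{1..n}. if x \<in> charging z j then 1 / real (card (swaps z j)) else 0)"
    using j by (intro sum_mono member_le_sum) auto
  also have "\<dots> \<le> (\<Sum>z\<in>dep. \<Sum>j\<in>{1..n}. if x \<in> charging z j then 1 / real (card (swaps z j)) else 0)"
    using Z(1) by (intro sum_mono2) (auto intro!: sum_nonneg)
  finally show ?thesis .
qed

lemma charging_load_le:
  assumes z: "z \<in> A" and "n \<ge> 1"
  shows "(\<Sum>j\<in>{1..n}. real (card (charging z j)) / real (card (swaps z j))) \<le> real (CARD('a) + n - 1)"
proof (cases "{j \<in> {1..n}. charging z j \<noteq> {}} = {}")
  case True
  then show ?thesis by (simp add: sum.neutral)
next
  case False
  let ?f = "\<lambda>j. real (card (charging z j)) / real (card (swaps z j))"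
  \<comment> \<open>With the least choice, every other index that carries a charge exceeds
    \<open>i\<close>, as \<open>card_charging_le_second\<close> requires. This yields
    \<open>CARD('a)\<close> once and 1 at most \<open>n - 1\<close> times.\<close>
  define i where "i = Min {j \<in> {1..n}. charging z j \<noteq> {}}"
  have fin: "finite {j \<in> {1..n}. charging z j \<noteq> {}}" by simp
  have i: "i \<in> {1..n}" "charging z i \<noteq> {}"
    using Min_in[OF fin False] unfolding i_def by auto
  have "?f i \<le> real CARD('a)"
    using of_nat_mono[OF card_charging_le[OF i(2)], where 'a = real]
    by (cases "card (swaps z i) = 0") (auto simp: divide_le_eq)
  moreover have "?f j \<le> 1" if "j \<in> {1..n} - {i}" for j
  proof (cases "charging z j = {}")
    case False
    then have "i \<le> j" unfolding i_def using that by (intro Min_le) auto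
    then have "card (charging z j) \<le> card (swaps z j)"
      using card_charging_le_second[OF z i(2) False] that by auto
    then show ?thesis by (cases "swaps z j = {}") (auto simp: divide_le_eq card_gt_0_iff)
  qed simp
  then have "(\<Sum>j\<in>{1..n} - {i}. ?f j) \<le> (\<Sum>j\<in>{1..n} - {i}. 1)" by (rule sum_mono)
  moreover have "(\<Sum>j\<in>{1..n}. ?f j) = ?f i + (\<Sum>j\<in>{1..n} - {i}. ?f j)"
    using i(1) by (intro sum.remove) auto
  ultimately show ?thesis using i(1) \<open>n \<ge> 1\<close> by (simp add: card_Diff_singleton of_nat_diff)
qed

lemma card_gen_minus_rigid_le:
  assumes "n \<ge> 1"
  shows "card (gen - rigid) \<le> (CARD('a) + n - 1) * card dep"
proof -
  let ?w = "\<lambda>x z j. if x \<in> charging z j then 1 / real (card (swaps z j)) else 0"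
  have "real (card (gen - rigid)) = (\<Sum>x\<in>gen - rigid. 1)" by simp
  also have "\<dots> \<le> (\<Sum>x\<in>gen - rigid. \<Sum>z\<in>dep. \<Sum>j\<in>{1..n}. ?w x z j)"
    by (intro sum_mono charging_weight_ge_1)
  also have "\<dots> = (\<Sum>z\<in>dep. \<Sum>j\<in>{1..n}. \<Sum>x\<in>gen - rigid. ?w x z j)"
    by (subst sum.swap) (intro sum.cong refl sum.swap)
  also have "\<dots> = (\<Sum>z\<in>dep. \<Sum>j\<in>{1..n}. real (card (charging z j)) / real (card (swaps z j)))"
  proof (intro sum.cong refl)
    fix z j
    have "(gen - rigid) \<inter> charging z j = charging z j" by (auto simp: charging_def)
    then show "(\<Sum>x\<in>gen - rigid. ?w x z j) = real (card (charging z j)) / real (card (swaps z j))"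
      by (simp add: sum.inter_restrict[symmetric])
  qed
  also have "\<dots> \<le> (\<Sum>z\<in>dep. real (CARD('a) + n - 1))"
    using assms by (intro sum_mono charging_load_le) (auto simp: dep_def)
  also have "\<dots> = real ((CARD('a) + n - 1) * card dep)" by simp
  finally show ?thesis by (simp only: of_nat_le_iff)
qed

section \<open>Rigid tuples and dual bases\<close>

text \<open>\<open>E j\<close> is spanned by \<open>x j\<close> and its intersection with the hull,
  and rigidity puts this intersection inside \<open>F j\<close>. Hence \<open>card (E j)\<close> is
  at most \<open>CARD('a)\<close> times the size of the intersection, while it is at least
  \<open>CARD('a) * card (F j)\<close>; equality holds throughout.\<close>

lemma rigid_E_inter_hull:
  assumes x: "x \<in> rigid" and j: "j \<in> {1..n}"
  shows "E j \<inter> hull_without n x j = F j" "card (E j) = CARD('a) * card (F j)"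
proof -
  have xg: "x \<in> gen" using x by (simp add: rigid_def)
  then have xA: "x \<in> A" by (simp add: gen_def)
  let ?T = "E j \<inter> hull_without n x j"
  have subT: "vec.subspace ?T" using subspace_E[OF j] by (simp add: vec.subspace_inter)
  have sub: "?T \<subseteq> F j" using x j by (auto simp: rigid_def degenerable_def swaps_def)
  have FE: "CARD('a) * card (F j) \<le> card (E j)"
    using card_proper_subspace_le[OF subspace_E[OF j] subspace_F[OF j] F_psubset_E[OF j]] .
  have span: "vec.span ?T = ?T" using subT by simp
  have xj: "x j \<notin> ?T" using sub A_memD[OF xA j] by auto
  have "E j \<subseteq> vec.span (insert (x j) ?T)"
  proof
    fix e assume e: "e \<in> E j"
    then obtain c where "e - c *s x j \<in> hull_without n x j"
      using gen_complement[OF xg j] E_subset_U[OF j] by blast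
    moreover have "e - c *s x j \<in> E j"
      using e gen_E[OF xg j] subspace_E[OF j] by (simp add: vec.subspace_diff vec.subspace_scale)
    ultimately show "e \<in> vec.span (insert (x j) ?T)"
      unfolding vec.span_breakdown_eq span by blast
  qed
  then have "card (E j) \<le> card (vec.span (insert (x j) ?T))" by (intro card_mono) auto
  also have "\<dots> = CARD('a) * card ?T" using card_span_insert[of "x j" ?T] xj span by simp
  finally have ET: "card (E j) \<le> CARD('a) * card ?T" .
  have "card ?T \<le> card (F j)" using sub by (intro card_mono) auto
  then have "CARD('a) * card ?T \<le> CARD('a) * card (F j)" by simp
  then have "CARD('a) * card ?T = CARD('a) * card (F j)" and eq: "card (E j) = CARD('a) * card (F j)"
    using FE ET by linarith+
  then have "card ?T = card (F j)" by simp
  then show "?T = F j" using sub by (intro card_subset_eq) auto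
  show "card (E j) = CARD('a) * card (F j)" by (rule eq)
qed

text \<open>
  The dual basis. The coordinate functionals vanish off the span of the basis because
  \<^const>\<open>vec.representation\<close> is 0 there.
\<close>

definition dual_family :: "(nat \<Rightarrow> 'a ^ 'm) \<Rightarrow> nat \<Rightarrow> 'a ^ 'm \<Rightarrow> 'a" where
  "dual_family x = (\<lambda>j\<in>{1..n}. \<lambda>v. vec.representation (x ` {1..n}) v (x j))"

definition admissible_functionals :: "nat \<Rightarrow> ('a ^ 'm \<Rightarrow> 'a) set" where
  "admissible_functionals j =
     {g \<in> functionals_on U. (\<forall>v\<in>F j. g v = 0) \<and> (\<exists>v\<in>E j. g v \<noteq> 0)}"

lemma gen_basis:
  assumes "x \<in> gen"
  shows "vec.independent (x ` {1..n})" "vec.span (x ` {1..n}) = U"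
  using assms indep_family_independent indep_family_span[OF _ image_subset_U subspace_U dim_U]
  by (auto simp: gen_def)

text \<open>The \<open>j\<close>-th coordinate vanishes on the span of the other basis vectors,
  which contains \<open>F j\<close> by rigidity, and is 1 at \<open>x j\<close>, which lies in
  \<open>E j\<close>.\<close>

lemma dual_family_mem:
  assumes x: "x \<in> rigid"
  shows "dual_family x \<in> (\<Pi>\<^sub>E j\<in>{1..n}. admissible_functionals j)"
  unfolding dual_family_def
proof (rule restrict_PiE_iff[THEN iffD2], rule ballI)
  fix j assume j: "j \<in> {1..n}"
  have xg: "x \<in> gen" using x by (simp add: rigid_def)
  note basis = gen_basis[OF xg]
  let ?g = "\<lambda>v. vec.representation (x ` {1..n}) v (x j)"
  have "?g \<in> functionals_on U"
    unfolding functionals_on_def using basis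
    by (auto simp: vec.representation_add vec.representation_scale)
       (simp add: vec.representation_def)
  moreover have "?g v = 0" if "v \<in> F j" for v
  proof -
    have v: "v \<in> vec.span (x ` ({1..n} - {j}))"
      using rigid_E_inter_hull(1)[OF x j] that by (auto simp: hull_without_def)
    have "?g v = vec.representation (x ` ({1..n} - {j})) v (x j)"
      using vec.representation_extend[OF basis(1) v image_mono[OF Diff_subset]] by simp
    moreover have "x j \<notin> x ` ({1..n} - {j})"
      using indep_family_image_Diff[OF _ j, of x] xg by (auto simp: gen_def)
    ultimately show ?thesis using vec.representation_ne_zero by metis
  qed
  moreover have "?g (x j) = 1" using vec.representation_basis[OF basis(1)] j by simp
  moreover have "x j \<in> E j" using gen_E[OF xg j] .
  ultimately show "?g \<in> admissible_functionals j"
    unfolding admissible_functionals_def by (auto intro!: bexI[of _ "x j"])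
qed

text \<open>A basis is determined by its dual basis: the coefficients of \<open>y i\<close> in the
  basis \<open>x\<close> are \<open>dual_family x j (y i) = dual_family y j (y i)\<close>, that is 1
  for \<open>j = i\<close> and 0 otherwise.\<close>

lemma inj_on_dual_family: "inj_on dual_family rigid"
proof (rule inj_onI)
  fix x y assume x: "x \<in> rigid" and y: "y \<in> rigid" and eq: "dual_family x = dual_family y"
  have xg: "x \<in> gen" "y \<in> gen" using x y by (simp_all add: rigid_def)
  note X = gen_basis[OF xg(1)] and Y = gen_basis[OF xg(2)]
  have injx: "inj_on x {1..n}" "inj_on y {1..n}"
    using xg indep_family_inj by (auto simp: gen_def)
  have expand: "(\<Sum>j\<in>{1..n}. dual_family w j v *s w j) = v" if "w \<in> gen" "v \<in> U" for w v
  proof -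
    have "(\<Sum>b\<in>w ` {1..n}. vec.representation (w ` {1..n}) v b *s b) = v"
      using gen_basis[OF that(1)] that(2) by (intro vec.sum_representation_eq) auto
    then show ?thesis
      using that(1) indep_family_inj[of n w]
      by (simp add: sum.reindex gen_def dual_family_def)
  qed
  have inU: "w i \<in> U" if "w \<in> gen" "i \<in> {1..n}" for w i
    using that A_memD(3) by (simp add: gen_def)
  show "x = y"
  proof (rule ext)
    fix i
    show "x i = y i"
    proof (cases "i \<in> {1..n}")
      case True
      have d: "dual_family w j (w i) = (if w i = w j then 1 else 0)" if "w \<in> gen" "j \<in> {1..n}" for w j
        using that True gen_basis[OF that(1)] by (auto simp: dual_family_def vec.representation_basis)
      have "x i = (\<Sum>j\<in>{1..n}. dual_family x j (x i) *s x j)"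
        using expand[OF xg(1) inU[OF xg(1) True]] by simp
      also have "\<dots> = (\<Sum>j\<in>{1..n}. dual_family y j (y i) *s x j)"
        using d xg True injx by (intro sum.cong refl) (auto simp: inj_on_eq_iff)
      also have "\<dots> = (\<Sum>j\<in>{1..n}. dual_family x j (y i) *s x j)" using eq by simp
      also have "\<dots> = y i"
        using expand[OF xg(1) inU[OF xg(2) True]] by simp
      finally show ?thesis .
    next
      case False
      then show ?thesis
        using xg PiE_arb[of x "{1..n}" "\<lambda>j. E j - F j" i] PiE_arb[of y "{1..n}" "\<lambda>j. E j - F j" i]
        by (simp add: gen_def A_def)
    qed
  qed
qed

lemma card_rigid_le:
  assumes n: "n \<ge> 1"
  shows "card rigid \<le> (CARD('a) - 1) ^ n * CARD('a) ^ (n * (n - 1) div 2)"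
proof (cases "rigid = {}")
  case False
  \<comment> \<open>One rigid tuple forces every \<open>F j\<close> to be a hyperplane of
    \<open>E j\<close>, which is needed for the size of \<open>E j - F j\<close> and for the count
    of functionals.\<close>
  then obtain x0 where x0: "x0 \<in> rigid" by auto
  let ?q = "CARD('a)"
  have "card rigid \<le> card A"
    by (intro card_mono) (auto simp: rigid_def gen_def)
  also have "\<dots> = (\<Prod>j\<in>{1..n}. card (E j - F j))"
    unfolding A_def by (rule card_PiE) simp
  finally have b1: "card rigid \<le> (\<Prod>j\<in>{1..n}. card (E j - F j))" .
  have "card rigid = card (dual_family ` rigid)" by (rule card_image[OF inj_on_dual_family, symmetric])
  also have "\<dots> \<le> card (\<Pi>\<^sub>E j\<in>{1..n}. admissible_functionals j)"
    using dual_family_mem by (intro card_mono finite_PiE) auto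
  also have "\<dots> = (\<Prod>j\<in>{1..n}. card (admissible_functionals j))" by (rule card_PiE) simp
  finally have b2: "card rigid \<le> (\<Prod>j\<in>{1..n}. card (admissible_functionals j))" .
  \<comment> \<open>The first factor is proportional to \<open>card (E j)\<close> and the bound for
    the second is inversely proportional to it, so \<open>card (E j)\<close> cancels.\<close>
  have factor: "card (E j - F j) * card (admissible_functionals j) \<le> (?q - 1)\<^sup>2 * ?q ^ (n - 1)"
    if j: "j \<in> {1..n}" for j
  proof -
    have cE: "card (E j) = ?q * card (F j)" using rigid_E_inter_hull[OF x0 j] by simp
    have "card (E j - F j) = card (E j) - card (F j)"
      using F_psubset_E[OF j] by (intro card_Diff_subset) auto
    then have d: "?q * card (E j - F j) = (?q - 1) * card (E j)"
      using cE by (simp add: diff_mult_distrib diff_mult_distrib2)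
    have "card (admissible_functionals j) * card (E j) \<le> (?q - 1) * card U"
      unfolding admissible_functionals_def
      by (rule card_functionals_le[OF subspace_E[OF j] subspace_F[OF j] subspace_U
          F_psubset_E[OF j] E_subset_U[OF j] cE])
    then have le: "(?q - 1) * (card (admissible_functionals j) * card (E j)) \<le> (?q - 1) * ((?q - 1) * card U)"
      by (rule mult_le_mono2)
    have cU: "card U = ?q * ?q ^ (n - 1)"
      using card_subspace[OF subspace_U] dim_U n by (simp add: power_eq_if)
    have "?q * (card (E j - F j) * card (admissible_functionals j))
        = (?q - 1) * (card (admissible_functionals j) * card (E j))"
      using d by (metis mult.assoc mult.commute)
    also note le
    also have "(?q - 1) * ((?q - 1) * card U) = ?q * ((?q - 1)\<^sup>2 * ?q ^ (n - 1))"
      by (simp only: cU power2_eq_square mult_ac)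
    finally show ?thesis by (simp only: mult_le_cancel1) simp
  qed
  have "(card rigid)\<^sup>2 \<le> (\<Prod>j\<in>{1..n}. card (E j - F j)) * (\<Prod>j\<in>{1..n}. card (admissible_functionals j))"
    unfolding power2_eq_square using b1 b2 by (rule mult_le_mono)
  also have "\<dots> = (\<Prod>j\<in>{1..n}. card (E j - F j) * card (admissible_functionals j))"
    by (simp add: prod.distrib)
  also have "\<dots> \<le> (\<Prod>j\<in>{1..n}. (?q - 1)\<^sup>2 * ?q ^ (n - 1))"
    using factor by (intro prod_mono) auto
  also have "\<dots> = ((?q - 1)\<^sup>2) ^ n * ?q ^ (n * (n - 1))"
    by (simp add: power_mult_distrib power_mult[symmetric] mult.commute)
  \<comment> \<open>The evenness of \<open>n * (n - 1)\<close> makes the bound a perfect square, so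
    that a root can be taken.\<close>
  also have "n * (n - 1) = (n * (n - 1) div 2) * 2"
    by (cases n) (simp_all del: mult_Suc mult_Suc_right)
  also have "((?q - 1)\<^sup>2) ^ n * ?q ^ ((n * (n - 1) div 2) * 2)
      = ((?q - 1) ^ n * ?q ^ (n * (n - 1) div 2))\<^sup>2"
    by (simp only: power_mult power_mult_distrib) (simp add: power_mult[symmetric] mult.commute)
  finally show ?thesis by (rule power2_le_imp_le) simp
qed simp

text \<open>The dependent tuples themselves are counted along with the charges, which raises the
  factor \<open>CARD('a) + n - 1\<close> by 1.\<close>

lemma card_A_le:
  assumes "n \<ge> 1"
  shows "card A \<le> (CARD('a) - 1) ^ n * CARD('a) ^ (n * (n - 1) div 2) + (CARD('a) + n) * card dep"
proof -
  have "card A = card gen + card dep"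
  proof -
    have "A = gen \<union> dep" "gen \<inter> dep = {}" by (auto simp: gen_def dep_def)
    then show ?thesis by (simp add: card_Un_disjoint)
  qed
  moreover have "card gen = card rigid + card (gen - rigid)"
    using card_Diff_subset[of rigid gen] card_mono[of gen rigid] by (auto simp: rigid_def)
  moreover have "(CARD('a) + n) * card dep = (CARD('a) + n - 1) * card dep + card dep"
  proof -
    have "CARD('a) + n = Suc (CARD('a) + n - 1)" using assms by simp
    then have "(CARD('a) + n) * card dep = Suc (CARD('a) + n - 1) * card dep" by (rule arg_cong)
    then show ?thesis by (simp only: mult_Suc add.commute)
  qed
  ultimately show ?thesis using card_rigid_le[OF assms] card_gen_minus_rigid_le[OF assms] by linarith
qed

end

section \<open>From projective points to nonzero vectors\<close>

definition nonzero_tuples :: "nat \<Rightarrow> (nat \<Rightarrow> 'a::field ^ 'm) set" where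
  "nonzero_tuples n = (\<Pi>\<^sub>E j\<in>{1..n}. UNIV - {0})"

text \<open>The preimage of \<open>A\<close> under the map that sends each nonzero vector to the
  point it spans. Restricting the lambda to \<open>{1..n}\<close> makes the image an extensional
  tuple.\<close>

definition lift_tuples :: "nat \<Rightarrow> (nat \<Rightarrow> ('a::field ^ 'm) set) set \<Rightarrow> (nat \<Rightarrow> 'a ^ 'm) set" where
  "lift_tuples n A = {x \<in> nonzero_tuples n. (\<lambda>j\<in>{1..n}. vec.span {x j}) \<in> A}"

lemma span_singleton_proj_point:
  assumes "v \<noteq> 0"
  shows "vec.span {v} \<in> proj_points"
proof -
  have "vec.independent {v}" using assms by (simp add: vec.independent_insert vec.independent_empty vec.span_empty)
  then have "vec.dim (vec.span {v}) = 1" using vec.dim_span_eq_card_independent by force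
  then show ?thesis by (simp add: proj_points_def)
qed

lemma span_singleton_in_flat_of:
  assumes "v \<noteq> 0" "vec.subspace W"
  shows "vec.span {v} \<in> flat_of W \<longleftrightarrow> v \<in> W"
proof
  assume "vec.span {v} \<in> flat_of W"
  then show "v \<in> W" using vec.span_base[of v "{v}"] by (auto simp: flat_of_def)
next
  assume "v \<in> W"
  then have "vec.span {v} \<subseteq> W" using assms(2) by (intro vec.span_minimal) auto
  then show "vec.span {v} \<in> flat_of W"
    using span_singleton_proj_point[OF assms(1)] by (simp add: flat_of_def)
qed

lemma flat_of_zero: "flat_of {0 :: 'a::field ^ 'm} = {}"
proof -
  have "p \<notin> flat_of {0 :: 'a ^ 'm}" for p
  proof
    assume "p \<in> flat_of {0 :: 'a ^ 'm}"
    then have "vec.dim p = 1" "p \<subseteq> {0}" by (auto simp: flat_of_def proj_points_def)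
    then show False using vec.dim_eq_0[of p] by simp
  qed
  then show ?thesis by blast
qed

text \<open>A full flat fits the same shape with the empty flat \<open>flat_of {0}\<close>
  removed.\<close>

lemma almost_flatE:
  assumes "almost_flat B"
  obtains W W' where "vec.subspace W" "vec.subspace W'" "B = flat_of W - flat_of W'"
proof (cases "is_flat B")
  case True
  then obtain W where "vec.subspace W" "B = flat_of W"
    unfolding is_flat_def k_flat_def by blast
  then show ?thesis using that[of W "{0}"] by (simp add: flat_of_zero vec.subspace_single_0)
next
  case False
  then show ?thesis using assms that unfolding almost_flat_def k_flat_def by metis
qed

text \<open>The removed flat may stick out of the larger one, so its space \<open>W'\<close> is
  replaced by \<open>W \<inter> W'\<close>; this is proper in \<open>W\<close> because
  \<open>B\<close> is nonempty. The zero vector lies in every subspace and hence drops out of the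
  difference.\<close>

lemma almost_flat_lift:
  assumes "almost_flat B" "B \<noteq> {}"
  shows "\<exists>E F. vec.subspace E \<and> vec.subspace F \<and> F \<subset> E \<and>
    (\<forall>v. v \<noteq> 0 \<and> vec.span {v} \<in> B \<longleftrightarrow> v \<in> E - F)"
proof -
  obtain W W' where W: "vec.subspace W" "vec.subspace W'" "B = flat_of W - flat_of W'"
    using almost_flatE[OF assms(1)] .
  have sub: "vec.subspace (W \<inter> W')" using W by (simp add: vec.subspace_inter)
  have "\<not> W \<subseteq> W'" using assms(2) W(3) by (auto simp: flat_of_def)
  then have "W \<inter> W' \<subset> W" by blast
  moreover have "v \<noteq> 0 \<and> vec.span {v} \<in> B \<longleftrightarrow> v \<in> W - W \<inter> W'" for v
  proof (cases "v = 0")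
    case True
    then show ?thesis using vec.subspace_0[OF sub] by simp
  next
    case False
    then show ?thesis using W span_singleton_in_flat_of[OF False] by auto
  qed
  ultimately show ?thesis using W(1) sub by blast
qed

text \<open>For \<open>f\<close> in \<open>F\<close> and \<open>e\<close> in \<open>E - F\<close>,
  both \<open>e\<close> and \<open>f + e\<close> lie in \<open>E - F\<close>, hence in
  \<open>U\<close>, and so does their difference \<open>f\<close>.\<close>

lemma subspace_Diff_subset_imp_subset:
  assumes "vec.subspace E" "vec.subspace F" "F \<subset> E" "vec.subspace U" "E - F \<subseteq> U"
  shows "E \<subseteq> U"
proof
  fix f assume f: "f \<in> E"
  obtain e where e: "e \<in> E" "e \<notin> F" using assms(3) by auto
  show "f \<in> U"
  proof (cases "f \<in> F")
    case True
    have "f + e \<notin> F"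
      using vec.subspace_diff[OF assms(2) _ True, of "f + e"] e(2) by auto
    moreover have "f + e \<in> E" using vec.subspace_add[OF assms(1) f e(1)] .
    ultimately have "f + e \<in> U" "e \<in> U" using e assms(5) by auto
    then show ?thesis using vec.subspace_diff[OF assms(4), of "f + e" e] by simp
  qed (use f assms(5) in auto)
qed

lemma lift_tuples_product:
  assumes A: "A = (\<Pi>\<^sub>E j\<in>{1..n}. B j)" "A \<noteq> {}" and B: "\<forall>j\<in>{1..n}. almost_flat (B j)"
    and L: "k_flat (int n - 1) L" "A \<subseteq> tuples n L"
  shows "\<exists>(U :: ('a::{field,finite} ^ 'm) set) E F. subspace_difference_product n U E F \<and>
    lift_tuples n A = (\<Pi>\<^sub>E j\<in>{1..n}. E j - F j)"
proof -
  obtain U where U: "vec.subspace U" "L = flat_of U" "vec.dim U = n"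
    using L(1) by (auto simp: k_flat_def)
  have ne: "B j \<noteq> {}" if "j \<in> {1..n}" for j
    using A that by (auto simp: PiE_eq_empty_iff)
  \<comment> \<open>An inclusion of products passes to the factors because the smaller product is
    nonempty.\<close>
  have "B j \<subseteq> L" if "j \<in> {1..n}" for j
    using L(2) A that unfolding tuples_def by (auto simp: subset_PiE)
  then have BU: "B j \<subseteq> flat_of U" if "j \<in> {1..n}" for j using that U(2) by simp
  have "\<forall>j\<in>{1..n}. \<exists>E F. vec.subspace E \<and> vec.subspace F \<and> F \<subset> E \<and>
    (\<forall>v. v \<noteq> 0 \<and> vec.span {v} \<in> B j \<longleftrightarrow> v \<in> E - F)"
    using B ne by (intro ballI almost_flat_lift) auto
  then obtain E where "\<forall>j\<in>{1..n}. \<exists>F. vec.subspace (E j) \<and> vec.subspace F \<and> F \<subset> E j \<and>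
      (\<forall>v. v \<noteq> 0 \<and> vec.span {v} \<in> B j \<longleftrightarrow> v \<in> E j - F)"
    by (rule bchoice[THEN exE])
  then obtain F where EF: "\<forall>j\<in>{1..n}. vec.subspace (E j) \<and> vec.subspace (F j) \<and> F j \<subset> E j \<and>
      (\<forall>v. v \<noteq> 0 \<and> vec.span {v} \<in> B j \<longleftrightarrow> v \<in> E j - F j)"
    by (rule bchoice[THEN exE])
  have E: "vec.subspace (E j)" "vec.subspace (F j)" "F j \<subset> E j"
    and mem: "\<And>v. v \<noteq> 0 \<and> vec.span {v} \<in> B j \<longleftrightarrow> v \<in> E j - F j" if "j \<in> {1..n}" for j
    using bspec[OF EF that] by simp_all
  have EU: "E j \<subseteq> U" if j: "j \<in> {1..n}" for j
  proof (rule subspace_Diff_subset_imp_subset[OF E[OF j] U(1)], rule subsetI)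
    fix v assume "v \<in> E j - F j"
    then have "v \<noteq> 0" "vec.span {v} \<in> B j" using mem[OF j, of v] by auto
    then show "v \<in> U" using BU[OF j] span_singleton_in_flat_of[OF _ U(1)] by blast
  qed
  have "subspace_difference_product n U E F"
    by (unfold_locales) (use U E EU in auto)
  moreover have "lift_tuples n A = (\<Pi>\<^sub>E j\<in>{1..n}. E j - F j)"
  proof (rule set_eqI)
    fix x
    have "x \<in> lift_tuples n A \<longleftrightarrow> x \<in> extensional {1..n} \<and>
        (\<forall>j\<in>{1..n}. x j \<noteq> 0 \<and> vec.span {x j} \<in> B j)"
      by (auto simp: lift_tuples_def nonzero_tuples_def A(1) PiE_iff)
    also have "\<dots> \<longleftrightarrow> x \<in> extensional {1..n} \<and> (\<forall>j\<in>{1..n}. x j \<in> E j - F j)"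
      using mem by blast
    also have "\<dots> \<longleftrightarrow> x \<in> (\<Pi>\<^sub>E j\<in>{1..n}. E j - F j)" by (auto simp: PiE_iff)
    finally show "x \<in> lift_tuples n A \<longleftrightarrow> x \<in> (\<Pi>\<^sub>E j\<in>{1..n}. E j - F j)" .
  qed
  ultimately show ?thesis by blast
qed

lemma card_lift_tuples_le:
  assumes "A = (\<Pi>\<^sub>E j\<in>{1..n}. B j)" "A \<noteq> {}" "\<forall>j\<in>{1..n}. almost_flat (B j)"
    and "k_flat (int n - 1) L" "A \<subseteq> tuples n L" "n \<ge> 1"
  shows "card (lift_tuples n A :: (nat \<Rightarrow> 'a::{field,finite} ^ 'm) set) \<le>
    (CARD('a) - 1) ^ n * CARD('a) ^ (n * (n - 1) div 2)
    + (CARD('a) + n) * card {x \<in> lift_tuples n A. \<not> indep_family n x}"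
proof -
  obtain U :: "('a ^ 'm) set" and E F where sdp: "subspace_difference_product n U E F"
    and lift: "lift_tuples n A = (\<Pi>\<^sub>E j\<in>{1..n}. E j - F j)"
    using lift_tuples_product[OF assms(1-5)] by blast
  interpret subspace_difference_product n U E F by (rule sdp)
  show ?thesis
    using card_A_le[OF assms(6)] unfolding dep_def A_def lift .
qed

section \<open>Counting dependent tuples\<close>

lemma finite_nonzero_tuples [simp]: "finite (nonzero_tuples n :: (nat \<Rightarrow> 'a::{field,finite} ^ 'm) set)"
  unfolding nonzero_tuples_def by (intro finite_PiE) auto

lemma card_span_le:
  fixes S :: "('a::{field,finite} ^ 'm) set"
  shows "card (vec.span S) \<le> CARD('a) ^ card S"
proof -
  have "vec.dim (vec.span S) \<le> card S" by (simp add: vec.dim_le_card')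
  then show ?thesis
    unfolding card_subspace[OF vec.subspace_span] by (intro power_increasing) auto
qed

text \<open>The other \<open>n - 1\<close> entries are free nonzero vectors, and \<open>x j\<close>
  is then confined to the span of \<open>j - 1\<close> of them.\<close>

lemma card_nonzero_tuples_dependent_at_le:
  assumes j: "j \<in> {1..n}"
  shows "card {x \<in> nonzero_tuples n :: (nat \<Rightarrow> 'a::{field,finite} ^ 'm) set. x j \<in> vec.span (x ` {1..<j})}
    \<le> (CARD('a ^ 'm) - 1) ^ (n - 1) * CARD('a) ^ (j - 1)"
proof -
  let ?X = "{x \<in> nonzero_tuples n :: (nat \<Rightarrow> 'a ^ 'm) set. x j \<in> vec.span (x ` {1..<j})}"
  let ?f = "\<lambda>x. (restrict x ({1..n} - {j}), x j)"
  let ?Y = "\<Pi>\<^sub>E i\<in>{1..n} - {j}. UNIV - {0 :: 'a ^ 'm}"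
  have fin: "finite ?Y" by (intro finite_PiE) auto
  have "inj_on ?f ?X"
  proof (rule inj_onI)
    fix x y assume x: "x \<in> ?X" and y: "y \<in> ?X" and eq: "?f x = ?f y"
    show "x = y"
    proof (rule ext)
      fix i
      show "x i = y i"
      proof (cases "i \<in> {1..n} - {j}")
        case True
        then show ?thesis using fun_cong[of _ _ i, OF conjunct1[OF eq[unfolded prod.inject]]] by simp
      next
        case False
        then show ?thesis using x y eq
          by (cases "i = j") (auto simp: nonzero_tuples_def PiE_iff extensional_def)
      qed
    qed
  qed
  then have "card ?X = card (?f ` ?X)" by (simp add: card_image)
  also have "\<dots> \<le> card (SIGMA y:?Y. vec.span (y ` {1..<j}))"
  proof (intro card_mono finite_SigmaI fin image_subsetI SigmaI)
    fix x assume x: "x \<in> ?X"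
    then show "restrict x ({1..n} - {j}) \<in> ?Y" by (auto simp: nonzero_tuples_def)
    have "restrict x ({1..n} - {j}) ` {1..<j} = x ` {1..<j}"
      using j by (intro image_cong) auto
    then show "x j \<in> vec.span (restrict x ({1..n} - {j}) ` {1..<j})" using x by simp
  qed simp
  also have "\<dots> = (\<Sum>y\<in>?Y. card (vec.span (y ` {1..<j})))"
    by (rule card_SigmaI[OF fin]) simp
  also have "\<dots> \<le> (\<Sum>y\<in>?Y. CARD('a) ^ (j - 1))"
  proof (rule sum_mono)
    fix y :: "nat \<Rightarrow> 'a ^ 'm"
    have "card (y ` {1..<j}) \<le> j - 1" using card_image_le[of "{1..<j}" y] by simp
    then show "card (vec.span (y ` {1..<j})) \<le> CARD('a) ^ (j - 1)"
      by (intro order_trans[OF card_span_le] power_increasing) auto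
  qed
  also have "\<dots> = card ?Y * CARD('a) ^ (j - 1)" by simp
  also have "card ?Y = (CARD('a ^ 'm) - 1) ^ (n - 1)"
    using j by (subst card_PiE) (simp_all add: card_Diff_singleton del: CARD_vec)
  finally show ?thesis .
qed

lemma card_nonzero_tuples_dependent_le:
  "card {x \<in> nonzero_tuples n :: (nat \<Rightarrow> 'a::{field,finite} ^ 'm) set. \<not> indep_family n x}
    \<le> (CARD('a ^ 'm) - 1) ^ (n - 1) * (\<Sum>j\<in>{1..n}. CARD('a) ^ (j - 1))"
proof -
  let ?X = "\<lambda>j. {x \<in> nonzero_tuples n :: (nat \<Rightarrow> 'a ^ 'm) set. x j \<in> vec.span (x ` {1..<j})}"
  have "{x \<in> nonzero_tuples n :: (nat \<Rightarrow> 'a ^ 'm) set. \<not> indep_family n x} \<subseteq> (\<Union>j\<in>{1..n}. ?X j)"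
  proof
    fix x assume x: "x \<in> {x \<in> nonzero_tuples n :: (nat \<Rightarrow> 'a ^ 'm) set. \<not> indep_family n x}"
    then obtain j where "j \<in> {1..n}" "x j \<in> vec.span (x ` {1..<j})"
      using indep_familyI_triangular[of n x] by (metis (no_types, lifting) mem_Collect_eq)
    then show "x \<in> (\<Union>j\<in>{1..n}. ?X j)" using x by blast
  qed
  then have "card {x \<in> nonzero_tuples n :: (nat \<Rightarrow> 'a ^ 'm) set. \<not> indep_family n x}
      \<le> card (\<Union>j\<in>{1..n}. ?X j)"
    by (intro card_mono) auto
  also have "\<dots> \<le> (\<Sum>j\<in>{1..n}. card (?X j))" by (rule card_UN_le) simp
  also have "\<dots> \<le> (\<Sum>j\<in>{1..n}. (CARD('a ^ 'm) - 1) ^ (n - 1) * CARD('a) ^ (j - 1))"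
    by (intro sum_mono card_nonzero_tuples_dependent_at_le)
  finally show ?thesis by (simp add: sum_distrib_left)
qed

section \<open>Summation over the partition and the final estimate\<close>

text \<open>The lifted parts partition the nonzero tuples. Their dependent tuples are disjoint as
  well, so the error terms of \<open>card_lift_tuples_le\<close> add up to a multiple of the total
  number of dependent tuples.\<close>

lemma partition_count:
  fixes P :: "(nat \<Rightarrow> ('a::{field,finite} ^ 'm) set) set set"
  assumes n: "n \<ge> 1" and P: "partition_on (tuples n (proj_points :: ('a ^ 'm) set set)) P"
    and prod: "\<And>A. A \<in> P \<Longrightarrow> \<exists>B. A = (\<Pi>\<^sub>E j\<in>{1..n}. B j) \<and> (\<forall>j\<in>{1..n}. almost_flat (B j))"
    and flat: "\<And>A. A \<in> P \<Longrightarrow> \<exists>L. k_flat (int n - 1) L \<and> A \<subseteq> tuples n L"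
  shows "(CARD('a ^ 'm) - 1) ^ n \<le> card P * ((CARD('a) - 1) ^ n * CARD('a) ^ (n * (n - 1) div 2))
    + (CARD('a) + n) * ((CARD('a ^ 'm) - 1) ^ (n - 1) * (\<Sum>j\<in>{1..n}. CARD('a) ^ (j - 1)))"
proof -
  let ?O = "nonzero_tuples n :: (nat \<Rightarrow> 'a ^ 'm) set"
  let ?K = "(CARD('a) - 1) ^ n * CARD('a) ^ (n * (n - 1) div 2)"
  let ?D = "\<lambda>A. {x \<in> lift_tuples n A. \<not> indep_family n x}"
  have "finite (tuples n (proj_points :: ('a ^ 'm) set set))"
    unfolding tuples_def by (intro finite_PiE) auto
  then have finP: "finite P" using P by (metis finite_elements)
  have cover: "?O = (\<Union>A\<in>P. lift_tuples n A)"
  proof (rule set_eqI)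
    fix x :: "nat \<Rightarrow> 'a ^ 'm"
    have "(\<lambda>j\<in>{1..n}. vec.span {x j}) \<in> \<Union>P" if "x \<in> ?O"
      unfolding partition_onD1[OF P, symmetric] tuples_def
      using that span_singleton_proj_point by (auto simp: nonzero_tuples_def PiE_iff)
    then show "x \<in> ?O \<longleftrightarrow> x \<in> (\<Union>A\<in>P. lift_tuples n A)" by (auto simp: lift_tuples_def)
  qed
  have disj: "lift_tuples n A \<inter> lift_tuples n A' = {}" if "A \<in> P" "A' \<in> P" "A \<noteq> A'" for A A'
    using partition_onD2[OF P] that unfolding disjoint_def lift_tuples_def by blast
  have fin: "finite (lift_tuples n A :: (nat \<Rightarrow> 'a ^ 'm) set)" for A
    unfolding lift_tuples_def by simp
  have "(CARD('a ^ 'm) - 1) ^ n = card ?O"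
    unfolding nonzero_tuples_def by (subst card_PiE) (simp_all add: card_Diff_singleton del: CARD_vec)
  also have "\<dots> = (\<Sum>A\<in>P. card (lift_tuples n A))"
    unfolding cover using finP fin disj by (intro card_UN_disjoint) auto
  also have "\<dots> \<le> (\<Sum>A\<in>P. ?K + (CARD('a) + n) * card (?D A))"
  proof (rule sum_mono)
    fix A assume A: "A \<in> P"
    then have "A \<noteq> {}" using partition_onD3[OF P] by auto
    then show "card (lift_tuples n A) \<le> ?K + (CARD('a) + n) * card (?D A)"
      using prod[OF A] flat[OF A] n by (elim exE conjE) (rule card_lift_tuples_le)
  qed
  also have "\<dots> = card P * ?K + (CARD('a) + n) * (\<Sum>A\<in>P. card (?D A))"
    by (simp add: sum.distrib sum_distrib_left)
  also have "(\<Sum>A\<in>P. card (?D A)) = card (\<Union>A\<in>P. ?D A)"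
    using finP fin disj by (intro card_UN_disjoint[symmetric]) auto
  also have "(\<Union>A\<in>P. ?D A) = {x \<in> ?O. \<not> indep_family n x}" unfolding cover by auto
  also have "card P * ?K + (CARD('a) + n) * card {x \<in> ?O. \<not> indep_family n x} \<le> card P * ?K
      + (CARD('a) + n) * ((CARD('a ^ 'm) - 1) ^ (n - 1) * (\<Sum>j\<in>{1..n}. CARD('a) ^ (j - 1)))"
    by (intro add_left_mono mult_le_mono2 card_nonzero_tuples_dependent_le)
  finally show ?thesis .
qed

text \<open>Division of \<open>le\<close> by \<open>(Q - 1) ^ n\<close> gives \<open>m ^ (n - 1) *
  (m - (Q + n) / (Q - 1) * S) \<le> N * Q ^ (n * (n - 1) div 2)\<close> with
  \<open>m = M / (Q - 1)\<close>, in the application the number of projective points. For positive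
  \<open>r\<close>, the left side is at least \<open>Q ^ (n * n) * r\<close>, and
  \<open>n * n\<close> is the sum of the two exponents \<open>n * (n - 1) div 2\<close> and
  \<open>n * (n + 1) div 2\<close>.\<close>

lemma numerical_bound:
  fixes Q :: real and n :: nat and N S M :: real
  assumes Q: "Q \<ge> 3" and n: "n \<ge> 1" and N: "N \<ge> 0" and S: "S * (Q - 1) \<le> Q ^ n"
    and M: "M = Q ^ (n + 1) - 1"
    and le: "M ^ n \<le> N * ((Q - 1) ^ n * Q ^ (n * (n - 1) div 2)) + (Q + real n) * (M ^ (n - 1) * S)"
  shows "N \<ge> Q ^ (n * (n + 1) div 2) * (1 - 1 / Q * ((Q + 1) / (Q - 2)) ^ n)"
proof -
  define r where "r = 1 - 1 / Q * ((Q + 1) / (Q - 2)) ^ n"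
  define m where "m = M / (Q - 1)"
  obtain k where k: "n = Suc k" using n by (cases n) auto
  have Mm: "M = m * (Q - 1)" using Q by (simp add: m_def)
  have "(Q ^ n + Q ^ (n - 1)) * (Q - 1) = Q * Q ^ n - Q ^ k"
    by (simp add: k algebra_simps)
  also have "\<dots> \<le> M" using M one_le_power[of Q k] Q by simp
  finally have m_ge: "m \<ge> Q ^ n + Q ^ (n - 1)"
    using Q by (simp add: m_def pos_le_divide_eq)
  have Qk: "Q ^ n = Q * Q ^ (n - 1)" by (simp add: k)
  have bern: "1 + real n * (3 / (Q - 2)) \<le> ((Q + 1) / (Q - 2)) ^ n"
  proof -
    have "(Q + 1) / (Q - 2) = 1 + 3 / (Q - 2)" using Q by (simp add: field_simps)
    then show ?thesis using Bernoulli_inequality[of "3 / (Q - 2)" n] Q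
      by (simp add: order_trans[of "-1" 0])
  qed
  \<comment> \<open>The denominator shrinks since \<open>(Q - 1)\<^sup>2 = Q * (Q - 2) + 1\<close>;
    the numerator grows since \<open>Q + 2 * n \<ge> 4\<close>. The new numerator is chosen to match
    the linear term of Bernoulli's inequality.\<close>
  have "(Q + real n) / (Q - 1)\<^sup>2 \<le> (2 * (Q - 2) + 3 * real n) / (Q * (Q - 2))"
    using Q n by (intro frac_le) (auto simp: power2_eq_square algebra_simps)
  also have "\<dots> = 2 / Q + 1 / Q * (real n * (3 / (Q - 2)))"
    using Q by (simp add: field_simps)
  finally have "1 + 1 / Q - (Q + real n) / (Q - 1)\<^sup>2 \<ge> 1 - 1 / Q * (1 + real n * (3 / (Q - 2)))"
    by (simp add: algebra_simps)
  moreover have "1 / Q * (1 + real n * (3 / (Q - 2))) \<le> 1 / Q * ((Q + 1) / (Q - 2)) ^ n"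
    using bern Q by (intro mult_left_mono) auto
  ultimately have r_le: "r \<le> 1 + 1 / Q - (Q + real n) / (Q - 1)\<^sup>2"
    unfolding r_def by linarith
  show ?thesis
  \<comment> \<open>For \<open>r \<le> 0\<close> the claimed bound is not positive. Positivity of
    \<open>r\<close> is what permits multiplying the lower bounds for the two factors in the other
    case.\<close>
  proof (cases "r \<le> 0")
    case True
    then have "Q ^ (n * (n + 1) div 2) * r \<le> 0" using Q by (intro mult_nonneg_nonpos) auto
    then show ?thesis using N unfolding r_def by linarith
  next
    case False
    have "S \<le> Q ^ n / (Q - 1)" using S Q by (simp add: pos_le_divide_eq)
    then have "(Q + real n) / (Q - 1) * S \<le> (Q + real n) / (Q - 1) * (Q ^ n / (Q - 1))"
      using Q by (intro mult_left_mono) auto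
    also have "\<dots> = Q ^ n * ((Q + real n) / (Q - 1)\<^sup>2)"
      by (simp add: power2_eq_square)
    finally have "m - (Q + real n) / (Q - 1) * S
        \<ge> Q ^ n + Q ^ (n - 1) - Q ^ n * ((Q + real n) / (Q - 1)\<^sup>2)"
      using m_ge by linarith
    also have "Q ^ n + Q ^ (n - 1) - Q ^ n * ((Q + real n) / (Q - 1)\<^sup>2)
        = Q ^ n * (1 + 1 / Q - (Q + real n) / (Q - 1)\<^sup>2)"
      using Q Qk by (simp add: algebra_simps)
    also have "\<dots> \<ge> Q ^ n * r" using r_le Q by (intro mult_left_mono) auto
    finally have bracket: "Q ^ n * r \<le> m - (Q + real n) / (Q - 1) * S" .
    have Qn: "Q ^ n \<le> m" using m_ge Q zero_le_power[of Q "n - 1"] by linarith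
    moreover have m0: "m \<ge> 0" using Qn Q zero_le_power[of Q n] by linarith
    ultimately have "(Q ^ n) ^ (n - 1) \<le> m ^ (n - 1)"
      using Q by (intro power_mono) auto
    then have "(Q ^ n) ^ (n - 1) * (Q ^ n * r) \<le> m ^ (n - 1) * (m - (Q + real n) / (Q - 1) * S)"
      using bracket False Q m0 by (intro mult_mono) auto
    also have "\<dots> \<le> N * Q ^ (n * (n - 1) div 2)"
    proof -
      have "(Q - 1) ^ n * (m ^ (n - 1) * (m - (Q + real n) / (Q - 1) * S))
          = M ^ n - (Q + real n) * (M ^ (n - 1) * S)"
      proof -
        have "(Q - 1) * (m - (Q + real n) / (Q - 1) * S) = M - (Q + real n) * S"
          using Q by (simp add: Mm right_diff_distrib mult.commute)
        moreover have "(Q - 1) ^ n * (m ^ (n - 1) * (m - (Q + real n) / (Q - 1) * S))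
            = M ^ (n - 1) * ((Q - 1) * (m - (Q + real n) / (Q - 1) * S))"
          by (simp only: k Mm power_mult_distrib power_Suc diff_Suc_1 mult_ac)
        ultimately show ?thesis by (simp add: k right_diff_distrib mult_ac)
      qed
      also have "\<dots> \<le> (Q - 1) ^ n * (N * Q ^ (n * (n - 1) div 2))"
        using le by (simp add: mult_ac)
      finally show ?thesis using Q by simp
    qed
    also have "(Q ^ n) ^ (n - 1) * (Q ^ n * r)
        = Q ^ (n * (n - 1) div 2) * (Q ^ (n * (n + 1) div 2) * r)"
    proof -
      have "n * n = n * (n - 1) div 2 + n * (n + 1) div 2"
      proof -
        have "even (n * (n - 1))" "even (n * (n + 1))" by (auto simp: k)
        then have "n * (n - 1) div 2 + n * (n + 1) div 2 = (n * (n - 1) + n * (n + 1)) div 2"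
          by (simp add: div_add)
        also have "n * (n - 1) + n * (n + 1) = 2 * (n * n)" by (simp add: k)
        finally show ?thesis by simp
      qed
      then have "Q ^ (n * n) = Q ^ (n * (n - 1) div 2 + n * (n + 1) div 2)" by (rule arg_cong)
      moreover have "(Q ^ n) ^ (n - 1) * Q ^ n = Q ^ (n * n)"
        by (simp add: k power_mult[symmetric] power_add[symmetric] algebra_simps)
      ultimately show ?thesis by (simp only: power_add mult.assoc[symmetric])
    qed
    finally have "Q ^ (n * (n - 1) div 2) * (Q ^ (n * (n + 1) div 2) * r)
        \<le> Q ^ (n * (n - 1) div 2) * N" by (simp add: mult.commute)
    then show ?thesis using Q unfolding r_def by simp
  qed
qed

theorem theorem1p3:
  fixes n q N :: nat
    and P :: "(nat \<Rightarrow> ('a::{field, finite} ^ 'm) set) set set"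
  assumes "n \<ge> 1"
    and "CARD('m) = n + 1"
    and "CARD('a) = q"
    and "q \<ge> 3"
    and "partition_on (tuples n (proj_points :: ('a ^ 'm) set set)) P"
    and "card P = N"
    and "\<And>A. A \<in> P \<Longrightarrow>
           \<exists>B. A = (\<Pi>\<^sub>E j\<in>{1..n}. B j) \<and> (\<forall>j\<in>{1..n}. almost_flat (B j))"
    and "\<And>A. A \<in> P \<Longrightarrow> \<exists>L. k_flat (int n - 1) L \<and> A \<subseteq> tuples n L"
  shows "real N \<ge> real q ^ (n * (n + 1) div 2)
           * (1 - 1 / real q * ((real q + 1) / (real q - 2)) ^ n)"
proof (rule numerical_bound)
  let ?M = "q ^ (n + 1) - 1"
  let ?S = "\<Sum>j\<in>{1..n}. q ^ (j - 1)"
  have cM: "CARD('a ^ 'm) = q ^ (n + 1)" using assms(2,3) by simp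
  have "?M ^ n \<le> N * ((q - 1) ^ n * q ^ (n * (n - 1) div 2)) + (q + n) * (?M ^ (n - 1) * ?S)"
    using partition_count[OF assms(1,5,7,8)] unfolding cM assms(3,6) .
  then have "real (?M ^ n) \<le>
      real (N * ((q - 1) ^ n * q ^ (n * (n - 1) div 2)) + (q + n) * (?M ^ (n - 1) * ?S))"
    by (rule of_nat_mono)
  moreover have "real (q - 1) = real q - 1" using assms(4) by (simp add: of_nat_diff)
  moreover have M: "real ?M = real q ^ (n + 1) - 1" using assms(4) by (simp add: of_nat_diff)
  ultimately show "real ?M ^ n \<le> real N * ((real q - 1) ^ n * real q ^ (n * (n - 1) div 2))
      + (real q + real n) * (real ?M ^ (n - 1) * real ?S)"
    by (simp only: of_nat_mult of_nat_add of_nat_power)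
  show "real ?M = real q ^ (n + 1) - 1" by (rule M)
  have "?S = (\<Sum>j<n. q ^ j)"
    by (rule sum.reindex_bij_witness[of _ Suc "\<lambda>j. j - 1"]) auto
  then have "real ?S = (\<Sum>j<n. real q ^ j)" by simp
  then have "real ?S * (real q - 1) = real q ^ n - 1"
    using power_diff_1_eq[of "real q" n] by (simp add: mult.commute)
  then show "real ?S * (real q - 1) \<le> real q ^ n" by simp
qed (use assms in auto)

end
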